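(* The function $\Phi:\mathbb{C}\to\mathbb{C}$, $\Phi(n)=\frac{1}{\phi^{n-1}}$ (the principal nFe-sequence), is a complex complete nFe-sequence, and it equals $\Omega_{1,1}$, that is, \[\Omega_{1,1}(n)=\Phi(n)\quad\text{for all } n\in\mathbb{C}.\]
   Context: $\phi=\frac{1+\sqrt5}{2}$. For complex $n$, $(-1)^n:=\exp(i\pi n)$, $\phi^n:=\exp(n\log\phi)$ with the real logarithm of $\phi$, and $(-\phi)^n:=(-1)^n\cdot\phi^n$. The function $\Theta:\mathbb{C}\to\mathbb{C}$ is $\Theta(n)=\frac{\phi^n-(-\phi)^{-n}}{\sqrt5}$. For $\eta,\gamma\in\mathbb{C}$, $\Omega_{\eta,\gamma}:\mathbb{C}\to\mathbb{C}$ is defined by $\Omega_{\eta,\gamma}(n)=\eta\cdot(-1)^{n-1}\cdot\Theta(n)+\gamma\cdot(-1)^{n}\cdot\Theta(n-1)\cdot\phi$. A function $\tilde\omega:\mathbb{C}\to\mathbb{C}$ is called a complex complete nFe-sequence (negaFibonacci-esque sequence) if $\tilde\omega(n)=\tilde\omega(n-2)-\tilde\omega(n-1)$ for all $n\in\mathbb{C}$. *)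

theory Defs
  imports Complex_Main
begin

definition golden :: real where
  "golden = (1 + sqrt 5) / 2"

text \<open>
  The three complex powers are separate functions because the branch is fixed by hand for each
  base; in particular the power of the negated golden ratio is a product of the two others.
\<close>

definition neg_one_pow :: "complex \<Rightarrow> complex" where
  "neg_one_pow n = exp (\<i> * of_real pi * n)"

definition golden_pow :: "complex \<Rightarrow> complex" where
  "golden_pow n = exp (n * of_real (ln golden))"

definition neg_golden_pow :: "complex \<Rightarrow> complex" where
  "neg_golden_pow n = neg_one_pow n * golden_pow n"

definition Theta :: "complex \<Rightarrow> complex" where
  "Theta n = (golden_pow n - neg_golden_pow (- n)) / of_real (sqrt 5)"

definition Omega :: "complex \<Rightarrow> complex \<Rightarrow> complex \<Rightarrow> complex" where
  "Omega \<eta> \<gamma> n =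
     \<eta> * neg_one_pow (n - 1) * Theta n + \<gamma> * neg_one_pow n * Theta (n - 1) * of_real golden"

definition complex_complete_nFe :: "(complex \<Rightarrow> complex) \<Rightarrow> bool" where
  "complex_complete_nFe w \<longleftrightarrow> (\<forall>n. w n = w (n - 2) - w (n - 1))"

definition principal_nFe :: "complex \<Rightarrow> complex" where
  "principal_nFe n = 1 / golden_pow (n - 1)"

end

theory Submission
  imports Defs
begin

text \<open>\<open>principal_nFe\<close> is geometric with ratio 1/\<open>golden\<close>, so the
  recurrence reduces to \<open>golden_square\<close>, the quadratic equation of the golden ratio.
  For \<open>Omega 1 1\<close>, write s = \<open>neg_one_pow n\<close> and g =
  \<open>golden_pow n\<close>: each \<open>Theta\<close> value has a part in g and a part in 1/(s *
  g). The g parts cancel between the two summands; the others leave (1 + \<open>golden\<close>^2) /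
  (\<open>sqrt 5\<close> * g), which \<open>one_plus_golden_square\<close> turns into
  \<open>golden\<close> / g.\<close>

lemma golden_pos: "golden > 0"
  unfolding golden_def by (simp add: add_pos_nonneg)

lemma golden_square: "golden\<^sup>2 = golden + 1"
  unfolding golden_def by (simp add: power2_eq_square field_simps)

text \<open>The roots \<open>golden\<close> and -1/\<open>golden\<close> of x^2 = x + 1 differ by
  \<open>sqrt 5\<close>; this is that fact multiplied by \<open>golden\<close>. It cancels the
  denominator of \<open>Theta\<close>.\<close>

lemma one_plus_golden_square: "1 + golden\<^sup>2 = golden * sqrt 5"
  unfolding golden_def by (simp add: power2_eq_square field_simps)

lemma golden_pow_nonzero: "golden_pow n \<noteq> 0"
  by (simp add: golden_pow_def)

lemma golden_pow_minus: "golden_pow (- n) = 1 / golden_pow n"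
  by (simp add: golden_pow_def exp_minus divide_inverse)

lemma golden_pow_1: "golden_pow 1 = of_real golden"
  using golden_pos by (simp add: golden_pow_def exp_of_real)

lemma golden_pow_diff: "golden_pow (m - n) = golden_pow m / golden_pow n"
  by (simp add: golden_pow_def left_diff_distrib exp_diff)

lemma golden_pow_diff_1: "golden_pow (n - 1) = golden_pow n / of_real golden"
  by (simp add: golden_pow_diff golden_pow_1)

lemma neg_one_pow_nonzero: "neg_one_pow n \<noteq> 0"
  by (simp add: neg_one_pow_def)

lemma neg_one_pow_minus: "neg_one_pow (- n) = 1 / neg_one_pow n"
  by (simp add: neg_one_pow_def exp_minus divide_inverse)

text \<open>Only exp(i * pi) = -1 enters, so the sign flip holds at every complex argument, although
  \<open>neg_one_pow n\<close> need not be 1 or -1 there.\<close>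

lemma neg_one_pow_diff_1: "neg_one_pow (n - 1) = - neg_one_pow n"
  by (simp add: neg_one_pow_def right_diff_distrib exp_diff)

lemma principal_nFe_altdef: "principal_nFe n = of_real golden / golden_pow n"
  by (simp add: principal_nFe_def golden_pow_diff_1)

lemma principal_nFe_diff_1: "principal_nFe (n - 1) = of_real golden * principal_nFe n"
  by (simp add: principal_nFe_altdef golden_pow_diff_1)

lemma complex_complete_nFe_principal: "complex_complete_nFe principal_nFe"
  unfolding complex_complete_nFe_def
proof
  fix n
  have "principal_nFe (n - 2) = (of_real golden)\<^sup>2 * principal_nFe n"
    using principal_nFe_diff_1[of "n - 1"]
    by (simp add: principal_nFe_diff_1 power2_eq_square)
  also have "(of_real golden)\<^sup>2 = (of_real golden + 1 :: complex)"
    by (metis golden_square of_real_add of_real_power of_real_1)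
  finally show "principal_nFe n = principal_nFe (n - 2) - principal_nFe (n - 1)"
    by (simp add: principal_nFe_diff_1 algebra_simps)
qed

lemma Omega_1_1: "Omega 1 1 n = principal_nFe n"
proof -
  define p r s g where "p = complex_of_real golden" and "r = complex_of_real (sqrt 5)"
    and "s = neg_one_pow n" and "g = golden_pow n"
  have nz: "p \<noteq> 0" "r \<noteq> 0" "s \<noteq> 0" "g \<noteq> 0"
    using golden_pos by (auto simp: p_def r_def s_def g_def neg_one_pow_nonzero golden_pow_nonzero)
  have pr: "1 + p\<^sup>2 = p * r"
    unfolding p_def r_def by (metis one_plus_golden_square of_real_add of_real_mult of_real_power of_real_1)
  have Theta_n: "Theta n = (g - 1 / (s * g)) / r"
    by (simp add: Theta_def neg_golden_pow_def neg_one_pow_minus golden_pow_minus r_def s_def g_def)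
  \<comment> \<open>The shift negates s, which turns the minus sign of \<open>Theta\<close> into a
    plus. The reciprocal rules are instantiated at \<open>n - 1\<close> because simp rewrites
    \<open>- (n - 1)\<close> to \<open>1 - n\<close>.\<close>
  have "Theta (n - 1) = (g / p + p / (s * g)) / r"
    using neg_one_pow_minus[of "n - 1"] golden_pow_minus[of "n - 1"]
    by (simp add: Theta_def neg_golden_pow_def neg_one_pow_diff_1 golden_pow_diff_1
        p_def r_def s_def g_def)
  with Theta_n have "Omega 1 1 n = - s * ((g - 1 / (s * g)) / r) + s * ((g / p + p / (s * g)) / r) * p"
    by (simp add: Omega_def neg_one_pow_diff_1 p_def s_def)
  also have "\<dots> = (1 + p\<^sup>2) / (r * g)"
    using nz by (simp add: field_simps power2_eq_square)
  also have "\<dots> = p / g"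
    using nz by (simp add: pr)
  finally show ?thesis
    by (simp add: principal_nFe_altdef p_def g_def)
qed

theorem theorem4p2:
  shows "complex_complete_nFe principal_nFe \<and> (\<forall>n::complex. Omega 1 1 n = principal_nFe n)"
  by (simp add: complex_complete_nFe_principal Omega_1_1)

end
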